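(* Let $N\in\mathbb{N}$ and let $T_i,S_i:L^1\to L^1$, $i=1,\dots,N$, be positive contractions such that $T_i\leq S_i$ for every $i=1,\dots,N$ and $$T_iT_j=T_jT_i,\qquad S_iS_j=S_jS_i\qquad\text{for every } i,j=1,\dots,N.$$ If there are $n_{i,0}\in\mathbb{N}$, $i=1,\dots,N$, such that $$\|S_1^{n_{1,0}}\cdots S_N^{n_{N,0}}-T_1^{n_{1,0}}\cdots T_N^{n_{N,0}}\|<1,$$ then $$\|S_1^{m_1}\cdots S_N^{m_N}-T_1^{m_1}\cdots T_N^{m_N}\|<1$$ for all $m_i\geq n_{i,0}$, $i=1,\dots,N$.
   Context: $(X,\mathcal{F},\mu)$ is a measure space with a positive $\sigma$-additive measure $\mu$, and $L^1=L^1(X,\mathcal{F},\mu)$ is the usual (real) $L^1$ space with its usual norm and pointwise a.e. order. A linear operator $T:L^1\to L^1$ is positive if $Tf\geq 0$ whenever $f\geq 0$; it is a positive contraction if it is positive and $\|T\|\leq 1$ (operator norm). For positive contractions $T,S$ on $L^1$, $T\leq S$ means that $S-T$ is a positive operator. $\mathbb{N}=\{1,2,\dots\}$. *)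

theory Defs
  imports "HOL-Analysis.Analysis"
begin

text \<open>
  The space \<open>L\<^sup>1(M)\<close> is handled through representatives: its elements are real functions that are
  integrable with respect to \<open>M\<close>, and two of them are identified when they agree almost
  everywhere. A linear operator on \<open>L\<^sup>1(M)\<close> is a map on functions that preserves integrability,
  respects almost everywhere equality and is linear up to almost everywhere equality; its values
  on non-integrable functions are irrelevant.
\<close>

definition l1_norm :: "'a measure \<Rightarrow> ('a \<Rightarrow> real) \<Rightarrow> real" where
  "l1_norm M f = (\<integral>x. \<bar>f x\<bar> \<partial>M)"

definition l1_linear :: "'a measure \<Rightarrow> (('a \<Rightarrow> real) \<Rightarrow> ('a \<Rightarrow> real)) \<Rightarrow> bool" where
  "l1_linear M T \<longleftrightarrow>
     (\<forall>f. integrable M f \<longrightarrow> integrable M (T f)) \<and>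
     (\<forall>f g. integrable M f \<longrightarrow> integrable M g \<longrightarrow>
        (AE x in M. f x = g x) \<longrightarrow> (AE x in M. T f x = T g x)) \<and>
     (\<forall>f g. integrable M f \<longrightarrow> integrable M g \<longrightarrow>
        (AE x in M. T (\<lambda>y. f y + g y) x = T f x + T g x)) \<and>
     (\<forall>c f. integrable M f \<longrightarrow> (AE x in M. T (\<lambda>y. c * f y) x = c * T f x))"

definition l1_positive :: "'a measure \<Rightarrow> (('a \<Rightarrow> real) \<Rightarrow> ('a \<Rightarrow> real)) \<Rightarrow> bool" where
  "l1_positive M T \<longleftrightarrow>
     (\<forall>f. integrable M f \<longrightarrow> (AE x in M. 0 \<le> f x) \<longrightarrow> (AE x in M. 0 \<le> T f x))"

text \<open>
  The operator norm takes values in \<^typ>\<open>ennreal\<close>, so that it is infinite for an unbounded operator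
  (the supremum of an unbounded set of reals would be unspecified).
\<close>

definition l1_opnorm :: "'a measure \<Rightarrow> (('a \<Rightarrow> real) \<Rightarrow> ('a \<Rightarrow> real)) \<Rightarrow> ennreal" where
  "l1_opnorm M T = (SUP f\<in>{f. integrable M f \<and> l1_norm M f \<le> 1}. ennreal (l1_norm M (T f)))"

definition l1_positive_contraction :: "'a measure \<Rightarrow> (('a \<Rightarrow> real) \<Rightarrow> ('a \<Rightarrow> real)) \<Rightarrow> bool" where
  "l1_positive_contraction M T \<longleftrightarrow> l1_linear M T \<and> l1_positive M T \<and> l1_opnorm M T \<le> 1"

definition l1_diff ::
    "(('a \<Rightarrow> real) \<Rightarrow> ('a \<Rightarrow> real)) \<Rightarrow> (('a \<Rightarrow> real) \<Rightarrow> ('a \<Rightarrow> real)) \<Rightarrow> ('a \<Rightarrow> real) \<Rightarrow> ('a \<Rightarrow> real)" where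
  "l1_diff S T = (\<lambda>f x. S f x - T f x)"

definition l1_le ::
    "'a measure \<Rightarrow> (('a \<Rightarrow> real) \<Rightarrow> ('a \<Rightarrow> real)) \<Rightarrow> (('a \<Rightarrow> real) \<Rightarrow> ('a \<Rightarrow> real)) \<Rightarrow> bool" where
  "l1_le M T S \<longleftrightarrow> l1_positive M (l1_diff S T)"

definition l1_op_eq ::
    "'a measure \<Rightarrow> (('a \<Rightarrow> real) \<Rightarrow> ('a \<Rightarrow> real)) \<Rightarrow> (('a \<Rightarrow> real) \<Rightarrow> ('a \<Rightarrow> real)) \<Rightarrow> bool" where
  "l1_op_eq M T S \<longleftrightarrow> (\<forall>f. integrable M f \<longrightarrow> (AE x in M. T f x = S f x))"

text \<open>\<open>prod_powers N T n\<close> is the composition \<open>T 1 ^^ n 1 \<circ> \<dots> \<circ> T N ^^ n N\<close>, in this order.\<close>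

definition prod_powers :: "nat \<Rightarrow> (nat \<Rightarrow> 'b \<Rightarrow> 'b) \<Rightarrow> (nat \<Rightarrow> nat) \<Rightarrow> 'b \<Rightarrow> 'b" where
  "prod_powers N T n = foldr (\<lambda>i P. (T i ^^ n i) \<circ> P) [1..<Suc N] id"

end

theory Submission
  imports Defs
begin

text \<open>
  On the positive cone of \<open>L\<^sup>1\<close> the norm is the integral, hence additive. The norm of a positive
  operator is the supremum over the cone, and for \<open>0 \<le> B \<le> A\<close> and \<open>f \<ge> 0\<close> the norm of \<open>(A - B) f\<close>
  is the mass of \<open>A f\<close> minus the mass of \<open>B f\<close>. If \<open>A\<close> is a contraction and \<open>f\<close> has mass one, this is
  close to one exactly when \<open>A\<close> loses almost no mass of \<open>f\<close> and \<open>B\<close> kills almost all of it. Moreover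
  the mass \<open>\<integral>f - \<integral>A f\<close> that a positive contraction loses is monotone in \<open>f\<close>.

  It suffices to raise one exponent by one. Let \<open>A\<close> and \<open>B\<close> be the products of powers of the \<open>S i\<close>
  and of the \<open>T i\<close> for the current exponents, with \<open>\<parallel>A - B\<parallel> \<le> q < 1\<close>, and let \<open>S\<close> and \<open>T\<close> be the
  factors whose exponent is raised. For \<open>f \<ge> 0\<close> of mass one, put
  \<open>d = 1 - \<parallel>S A f - T B f\<parallel> = (1 - \<integral>S A f) + \<integral>T B f\<close>.
  The first summand bounds the mass that \<open>A\<close> loses on \<open>T f\<close>, because \<open>T f \<le> S f\<close> and \<open>A S = S A\<close>; the
  second one is the mass of \<open>B T f = T B f\<close>. So \<open>A - B\<close> reduces the mass of \<open>T f\<close> by at most \<open>d\<close>, and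
  also by at least \<open>1 - q\<close> times that mass: \<open>T f\<close> has mass at most \<open>d / (1 - q)\<close>. The exponent of \<open>T\<close>
  in \<open>B\<close> is positive, so \<open>B\<close> factors through \<open>T\<close> and \<open>B f\<close> has at most this mass as well, while \<open>A f\<close>
  has mass at least \<open>1 - d\<close>. Applying \<open>\<parallel>A - B\<parallel> \<le> q\<close> to \<open>f\<close> now gives
  \<open>1 - q \<le> d + d / (1 - q)\<close>, a lower bound on \<open>d\<close> that does not depend on \<open>f\<close>.

  This is \<open>opnorm_diff_less_one_step\<close>. Commutativity of the factors brings products with one exponent
  raised into the shape that it needs (\<open>monomial_raise_exponent\<close>), and induction on the sum of the
  exponents finishes the proof.
\<close>

section \<open>Operators on integrable functions\<close>

lemma l1_linearD:
  assumes "l1_linear M T"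
  shows l1_linear_integrable: "integrable M f \<Longrightarrow> integrable M (T f)"
    and l1_linear_cong: "\<lbrakk>integrable M f; integrable M g; AE x in M. f x = g x\<rbrakk>
          \<Longrightarrow> AE x in M. T f x = T g x"
    and l1_linear_add: "\<lbrakk>integrable M f; integrable M g\<rbrakk>
          \<Longrightarrow> AE x in M. T (\<lambda>y. f y + g y) x = T f x + T g x"
    and l1_linear_scale: "integrable M f \<Longrightarrow> AE x in M. T (\<lambda>y. c * f y) x = c * T f x"
  using assms unfolding l1_linear_def by blast+

lemma l1_linear_minus:
  assumes T: "l1_linear M T" and f: "integrable M f" and g: "integrable M g"
  shows "AE x in M. T (\<lambda>y. f y - g y) x = T f x - T g x"
proof -
  have "AE x in M. T (\<lambda>y. f y + (-1) * g y) x = T f x + T (\<lambda>y. (-1) * g y) x"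
    using f g by (intro l1_linear_add[OF T]) auto
  moreover have "AE x in M. T (\<lambda>y. (-1) * g y) x = (-1) * T g x"
    using T g by (rule l1_linear_scale)
  ultimately show ?thesis
    by eventually_elim simp
qed

lemma l1_linear_id: "l1_linear M id"
  by (simp add: l1_linear_def)

lemma l1_linear_comp:
  assumes T: "l1_linear M T" and S: "l1_linear M S"
  shows "l1_linear M (T \<circ> S)"
proof -
  have add: "AE x in M. T (S (\<lambda>y. f y + g y)) x = T (S f) x + T (S g) x"
    if f: "integrable M f" and g: "integrable M g" for f g
  proof -
    have "AE x in M. T (S (\<lambda>y. f y + g y)) x = T (\<lambda>y. S f y + S g y) x"
      using f g
      by (intro l1_linear_cong[OF T] l1_linear_add[OF S] l1_linear_integrable[OF S]
            Bochner_Integration.integrable_add)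
    moreover have "AE x in M. T (\<lambda>y. S f y + S g y) x = T (S f) x + T (S g) x"
      using f g by (intro l1_linear_add[OF T] l1_linear_integrable[OF S])
    ultimately show ?thesis by eventually_elim simp
  qed
  have scale: "AE x in M. T (S (\<lambda>y. c * f y)) x = c * T (S f) x"
    if f: "integrable M f" for c f
  proof -
    have "AE x in M. T (S (\<lambda>y. c * f y)) x = T (\<lambda>y. c * S f y) x"
      using f
      by (intro l1_linear_cong[OF T] l1_linear_scale[OF S] l1_linear_integrable[OF S]
            integrable_mult_right)
    moreover have "AE x in M. T (\<lambda>y. c * S f y) x = c * T (S f) x"
      using f by (intro l1_linear_scale[OF T] l1_linear_integrable[OF S])
    ultimately show ?thesis by eventually_elim simp
  qed
  show ?thesis
    unfolding l1_linear_def o_apply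
  proof (intro conjI allI impI)
    fix f g :: "'a \<Rightarrow> real" assume f: "integrable M f"
    show "integrable M (T (S f))"
      by (intro l1_linear_integrable[OF T] l1_linear_integrable[OF S] f)
    assume g: "integrable M g" and fg: "AE x in M. f x = g x"
    show "AE x in M. T (S f) x = T (S g) x"
      by (intro l1_linear_cong[OF T] l1_linear_cong[OF S] l1_linear_integrable[OF S] f g fg)
  qed (intro add scale; assumption)+
qed

lemma l1_linear_funpow: "l1_linear M T \<Longrightarrow> l1_linear M (T ^^ n)"
  by (induction n) (simp_all add: l1_linear_id l1_linear_comp)

lemma l1_linear_diff:
  assumes S: "l1_linear M S" and T: "l1_linear M T"
  shows "l1_linear M (l1_diff S T)"
  unfolding l1_linear_def l1_diff_def
proof (intro conjI allI impI)
  fix f g :: "'a \<Rightarrow> real" and c :: real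
  assume f: "integrable M f"
  show "integrable M (\<lambda>x. S f x - T f x)"
    using f l1_linear_integrable[OF S] l1_linear_integrable[OF T] by simp
  show "AE x in M. S (\<lambda>y. c * f y) x - T (\<lambda>y. c * f y) x = c * (S f x - T f x)"
    using l1_linear_scale[OF S f, of c] l1_linear_scale[OF T f, of c]
    by eventually_elim (simp add: algebra_simps)
  assume g: "integrable M g"
  show "AE x in M. S (\<lambda>y. f y + g y) x - T (\<lambda>y. f y + g y) x
          = S f x - T f x + (S g x - T g x)"
    using l1_linear_add[OF S f g] l1_linear_add[OF T f g] by eventually_elim simp
  assume fg: "AE x in M. f x = g x"
  show "AE x in M. S f x - T f x = S g x - T g x"
    using l1_linear_cong[OF S f g fg] l1_linear_cong[OF T f g fg] by eventually_elim simp
qed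

lemma l1_positiveD:
  "\<lbrakk>l1_positive M T; integrable M f; AE x in M. 0 \<le> f x\<rbrakk> \<Longrightarrow> AE x in M. 0 \<le> T f x"
  by (simp add: l1_positive_def)

lemma l1_positive_mono:
  assumes "l1_linear M T" "l1_positive M T" "integrable M f" "integrable M g"
    and "AE x in M. f x \<le> g x"
  shows "AE x in M. T f x \<le> T g x"
proof -
  have "AE x in M. 0 \<le> T (\<lambda>y. g y - f y) x"
    using assms by (intro l1_positiveD[OF assms(2)]) auto
  with l1_linear_minus[OF assms(1,4,3)] show ?thesis
    by eventually_elim simp
qed

section \<open>Equality and order of operators\<close>

lemma l1_op_eqD: "\<lbrakk>l1_op_eq M T S; integrable M f\<rbrakk> \<Longrightarrow> AE x in M. T f x = S f x"
  by (simp add: l1_op_eq_def)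

lemma l1_op_eq_refl: "l1_op_eq M T T"
  by (simp add: l1_op_eq_def)

lemma l1_op_eq_sym: "l1_op_eq M T S \<Longrightarrow> l1_op_eq M S T"
  by (simp add: l1_op_eq_def eq_commute)

lemma l1_op_eq_trans [trans]: "\<lbrakk>l1_op_eq M T S; l1_op_eq M S R\<rbrakk> \<Longrightarrow> l1_op_eq M T R"
  unfolding l1_op_eq_def
proof (intro allI impI)
  fix f :: "'a \<Rightarrow> real"
  assume "\<forall>f. integrable M f \<longrightarrow> (AE x in M. T f x = S f x)"
    and "\<forall>f. integrable M f \<longrightarrow> (AE x in M. S f x = R f x)" and f: "integrable M f"
  then have "AE x in M. T f x = S f x" "AE x in M. S f x = R f x"
    by auto
  then show "AE x in M. T f x = R f x"
    by eventually_elim simp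
qed

lemma l1_op_eq_comp_right:
  "\<lbrakk>l1_op_eq M T S; l1_linear M R\<rbrakk> \<Longrightarrow> l1_op_eq M (T \<circ> R) (S \<circ> R)"
  using l1_linear_integrable[of M R] by (simp add: l1_op_eq_def)

lemma l1_op_eq_comp_left:
  "\<lbrakk>l1_op_eq M T S; l1_linear M R; l1_linear M T; l1_linear M S\<rbrakk>
    \<Longrightarrow> l1_op_eq M (R \<circ> T) (R \<circ> S)"
  using l1_linear_integrable[of M T] l1_linear_integrable[of M S] l1_linear_cong[of M R]
  by (simp add: l1_op_eq_def)

lemma l1_opnorm_diff_cong:
  assumes "l1_op_eq M S S'" "l1_op_eq M T T'" "l1_linear M S" "l1_linear M S'"
    "l1_linear M T" "l1_linear M T'"
  shows "l1_opnorm M (l1_diff S T) = l1_opnorm M (l1_diff S' T')"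
proof -
  have "l1_norm M (l1_diff S T f) = l1_norm M (l1_diff S' T' f)" if f: "integrable M f" for f
  proof -
    have [measurable]: "S f \<in> borel_measurable M" "S' f \<in> borel_measurable M"
        "T f \<in> borel_measurable M" "T' f \<in> borel_measurable M"
      using f assms(3-6)[THEN l1_linear_integrable] by auto
    have "AE x in M. \<bar>S f x - T f x\<bar> = \<bar>S' f x - T' f x\<bar>"
      using l1_op_eqD[OF assms(1) f] l1_op_eqD[OF assms(2) f] by eventually_elim simp
    then show ?thesis
      unfolding l1_norm_def l1_diff_def by (intro integral_cong_AE) auto
  qed
  then show ?thesis
    unfolding l1_opnorm_def by (intro SUP_cong) auto
qed

lemma l1_le_refl: "l1_le M T T"
  by (simp add: l1_le_def l1_positive_def l1_diff_def)

lemma l1_leD: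
  assumes "l1_le M T S" "integrable M f" "AE x in M. 0 \<le> f x"
  shows "AE x in M. T f x \<le> S f x"
  using assms unfolding l1_le_def l1_positive_def l1_diff_def by auto

lemma l1_le_comp:
  assumes T: "l1_linear M T" "l1_positive M T" and S: "l1_linear M S" "l1_positive M S"
    and T': "l1_linear M T'" "l1_positive M T'" and S': "l1_linear M S'"
    and le: "l1_le M T S" and le': "l1_le M T' S'"
  shows "l1_le M (T \<circ> T') (S \<circ> S')"
  unfolding l1_le_def l1_positive_def
proof (intro allI impI)
  fix f :: "'a \<Rightarrow> real"
  assume f: "integrable M f" "AE x in M. 0 \<le> f x"
  have "AE x in M. T (T' f) x \<le> S (T' f) x"
    using f by (intro l1_leD[OF le] l1_linear_integrable[OF T'(1)] l1_positiveD[OF T'(2)])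
  moreover have "AE x in M. S (T' f) x \<le> S (S' f) x"
    using f
    by (intro l1_positive_mono[OF S] l1_leD[OF le'] l1_linear_integrable[OF T'(1)]
          l1_linear_integrable[OF S'])
  ultimately show "AE x in M. 0 \<le> l1_diff (S \<circ> S') (T \<circ> T') f x"
    unfolding l1_diff_def comp_def by eventually_elim simp
qed

section \<open>The operator norm\<close>

lemma l1_norm_le_opnorm:
  assumes T: "l1_linear M T" and f: "integrable M f"
    and le: "l1_opnorm M T \<le> ennreal r" and r: "0 \<le> r"
  shows "l1_norm M (T f) \<le> r * l1_norm M f"
proof (cases "l1_norm M f = 0")
  case True
  then have "AE x in M. f x = 0"
    using f by (simp add: l1_norm_def integral_nonneg_eq_0_iff_AE)
  then have "AE x in M. f x = 0 * f x"
    by simp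
  then have "AE x in M. T f x = T (\<lambda>y. 0 * f y) x"
    using f by (intro l1_linear_cong[OF T]) auto
  then have "AE x in M. \<bar>T f x\<bar> = 0"
    using l1_linear_scale[OF T f, of 0] by eventually_elim simp
  then have "l1_norm M (T f) = 0"
    unfolding l1_norm_def by (rule integral_eq_zero_AE)
  with True show ?thesis by simp
next
  case False
  define c where "c = 1 / l1_norm M f"
  have c: "0 < c"
    using False unfolding c_def l1_norm_def by (simp add: integral_nonneg less_le)
  have Tf: "integrable M (T f)"
    using T f by (rule l1_linear_integrable)
  have cf: "integrable M (\<lambda>y. c * f y)"
    using f by simp
  have "l1_norm M (\<lambda>y. c * f y) = c * l1_norm M f"
    using c by (simp add: l1_norm_def abs_mult)
  then have "l1_norm M (\<lambda>y. c * f y) \<le> 1"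
    using False by (simp add: c_def)
  then have "ennreal (l1_norm M (T (\<lambda>y. c * f y))) \<le> l1_opnorm M T"
    using cf unfolding l1_opnorm_def by (intro SUP_upper) simp
  then have "l1_norm M (T (\<lambda>y. c * f y)) \<le> r"
    using le r by (metis ennreal_le_iff order_trans)
  moreover have "l1_norm M (T (\<lambda>y. c * f y)) = c * l1_norm M (T f)"
  proof -
    have "AE x in M. \<bar>T (\<lambda>y. c * f y) x\<bar> = c * \<bar>T f x\<bar>"
      using l1_linear_scale[OF T f, of c] by eventually_elim (use c in \<open>simp add: abs_mult\<close>)
    then have "l1_norm M (T (\<lambda>y. c * f y)) = (\<integral>x. c * \<bar>T f x\<bar> \<partial>M)"
      unfolding l1_norm_def using Tf l1_linear_integrable[OF T cf]
      by (intro integral_cong_AE) auto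
    then show ?thesis by (simp add: l1_norm_def)
  qed
  ultimately have "c * l1_norm M (T f) \<le> r"
    by simp
  moreover have "0 < l1_norm M f"
    using c by (simp add: c_def)
  ultimately show ?thesis
    by (simp add: c_def field_simps)
qed

lemma l1_norm_nonneg_fun:
  assumes "integrable M f" "AE x in M. 0 \<le> f x"
  shows "l1_norm M f = (\<integral>x. f x \<partial>M)"
  unfolding l1_norm_def using assms by (intro integral_cong_AE) auto

text \<open>
  A positive operator satisfies \<open>\<bar>R f\<bar> \<le> R \<bar>f\<bar>\<close>, so its norm is controlled by its action on the
  positive cone.
\<close>

lemma l1_opnorm_le_of_cone:
  assumes R: "l1_linear M R" "l1_positive M R" and r: "0 \<le> r"
    and cone: "\<And>f. \<lbrakk>integrable M f; AE x in M. 0 \<le> f x\<rbrakk>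
                \<Longrightarrow> (\<integral>x. R f x \<partial>M) \<le> r * (\<integral>x. f x \<partial>M)"
  shows "l1_opnorm M R \<le> ennreal r"
  unfolding l1_opnorm_def
proof (rule SUP_least)
  fix f assume "f \<in> {f. integrable M f \<and> l1_norm M f \<le> 1}"
  then have f: "integrable M f" and f1: "l1_norm M f \<le> 1"
    by auto
  have af: "integrable M (\<lambda>x. \<bar>f x\<bar>)"
    using f by simp
  have "AE x in M. R f x \<le> R (\<lambda>x. \<bar>f x\<bar>) x"
    using f by (intro l1_positive_mono[OF R]) auto
  moreover have "AE x in M. R (\<lambda>y. (-1) * f y) x \<le> R (\<lambda>x. \<bar>f x\<bar>) x"
    using f by (intro l1_positive_mono[OF R]) auto
  ultimately have "AE x in M. \<bar>R f x\<bar> \<le> R (\<lambda>x. \<bar>f x\<bar>) x"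
    using l1_linear_scale[OF R(1) f, of "-1"] by eventually_elim simp
  then have "l1_norm M (R f) \<le> (\<integral>x. R (\<lambda>x. \<bar>f x\<bar>) x \<partial>M)"
    unfolding l1_norm_def using f af
    by (intro integral_mono_AE integrable_abs l1_linear_integrable[OF R(1)])
  also have "\<dots> \<le> r * (\<integral>x. \<bar>f x\<bar> \<partial>M)"
    using af by (intro cone) auto
  also have "\<dots> \<le> r"
    using mult_left_mono[OF f1 r] by (simp add: l1_norm_def)
  finally show "ennreal (l1_norm M (R f)) \<le> ennreal r"
    by (rule ennreal_leI)
qed

section \<open>Positive contractions\<close>

lemma l1_positive_contractionD:
  assumes "l1_positive_contraction M T"
  shows positive_contraction_linear: "l1_linear M T"
    and positive_contraction_positive: "l1_positive M T"
  using assms by (auto simp: l1_positive_contraction_def)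

lemma positive_contraction_integral_le:
  assumes T: "l1_positive_contraction M T" and f: "integrable M f" "AE x in M. 0 \<le> f x"
  shows "(\<integral>x. T f x \<partial>M) \<le> (\<integral>x. f x \<partial>M)"
proof -
  have Tf: "integrable M (T f)" "AE x in M. 0 \<le> T f x"
    using l1_linear_integrable[OF positive_contraction_linear[OF T]]
      l1_positiveD[OF positive_contraction_positive[OF T]] f by auto
  have "l1_norm M (T f) \<le> 1 * l1_norm M f"
    using T f by (intro l1_norm_le_opnorm) (auto simp: l1_positive_contraction_def)
  then show ?thesis
    using f Tf by (simp add: l1_norm_nonneg_fun)
qed

lemma positive_contractionI:
  assumes "l1_linear M T" "l1_positive M T"
    and "\<And>f. \<lbrakk>integrable M f; AE x in M. 0 \<le> f x\<rbrakk> \<Longrightarrow> (\<integral>x. T f x \<partial>M) \<le> (\<integral>x. f x \<partial>M)"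
  shows "l1_positive_contraction M T"
  using l1_opnorm_le_of_cone[of M T 1] assms by (simp add: l1_positive_contraction_def)

lemma positive_contraction_id: "l1_positive_contraction M id"
  by (rule positive_contractionI) (auto simp: l1_linear_id l1_positive_def)

lemma positive_contraction_comp:
  assumes T: "l1_positive_contraction M T" and S: "l1_positive_contraction M S"
  shows "l1_positive_contraction M (T \<circ> S)"
proof (rule positive_contractionI)
  note lin = T[THEN positive_contraction_linear] S[THEN positive_contraction_linear]
  note pos = T[THEN positive_contraction_positive] S[THEN positive_contraction_positive]
  show "l1_linear M (T \<circ> S)"
    using lin by (rule l1_linear_comp)
  show "l1_positive M (T \<circ> S)"
    using l1_linear_integrable[OF lin(2)] pos by (simp add: l1_positive_def)
  fix f :: "'a \<Rightarrow> real"
  assume f: "integrable M f" "AE x in M. 0 \<le> f x"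
  have "(\<integral>x. T (S f) x \<partial>M) \<le> (\<integral>x. S f x \<partial>M)"
    using f
    by (intro positive_contraction_integral_le[OF T] l1_linear_integrable[OF lin(2)]
          l1_positiveD[OF pos(2)])
  also have "\<dots> \<le> (\<integral>x. f x \<partial>M)"
    using S f by (rule positive_contraction_integral_le)
  finally show "(\<integral>x. (T \<circ> S) f x \<partial>M) \<le> (\<integral>x. f x \<partial>M)"
    by simp
qed

lemma l1_le_comp_contractions:
  assumes "l1_positive_contraction M T" "l1_positive_contraction M S"
    "l1_positive_contraction M T'" "l1_positive_contraction M S'"
    and "l1_le M T S" "l1_le M T' S'"
  shows "l1_le M (T \<circ> T') (S \<circ> S')"
  using assms by (intro l1_le_comp) (auto dest: l1_positive_contractionD)

lemma positive_contraction_funpow: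
  "l1_positive_contraction M T \<Longrightarrow> l1_positive_contraction M (T ^^ n)"
  by (induction n) (simp_all add: positive_contraction_id positive_contraction_comp)

lemma l1_le_funpow:
  assumes "l1_positive_contraction M T" "l1_positive_contraction M S" "l1_le M T S"
  shows "l1_le M (T ^^ n) (S ^^ n)"
  using assms
  by (induction n)
    (simp_all add: l1_le_refl l1_le_comp_contractions positive_contraction_funpow)

text \<open>
  The loss \<open>\<integral>f - \<integral>A f\<close> is linear in \<open>f\<close> and nonnegative on the cone.
\<close>

lemma positive_contraction_loss_mono:
  assumes A: "l1_positive_contraction M A"
    and f: "integrable M f" and g: "integrable M g" and le: "AE x in M. f x \<le> g x"
  shows "(\<integral>x. f x \<partial>M) - (\<integral>x. A f x \<partial>M) \<le> (\<integral>x. g x \<partial>M) - (\<integral>x. A g x \<partial>M)"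
proof -
  note lin = A[THEN positive_contraction_linear]
  have Af: "integrable M (A f)" and Ag: "integrable M (A g)"
    and Agf: "integrable M (A (\<lambda>x. g x - f x))"
    using f g by (auto intro!: l1_linear_integrable[OF lin])
  have "(\<integral>x. A g x \<partial>M) - (\<integral>x. A f x \<partial>M) = (\<integral>x. A g x - A f x \<partial>M)"
    using Af Ag by simp
  also have "\<dots> = (\<integral>x. A (\<lambda>x. g x - f x) x \<partial>M)"
    using Af Ag Agf l1_linear_minus[OF lin g f] by (intro integral_cong_AE) auto
  also have "\<dots> \<le> (\<integral>x. g x - f x \<partial>M)"
    using f g le by (intro positive_contraction_integral_le[OF A]) auto
  also have "\<dots> = (\<integral>x. g x \<partial>M) - (\<integral>x. f x \<partial>M)"
    using f g by simp
  finally show ?thesis by simp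
qed

section \<open>Raising one exponent\<close>

text \<open>
  In the application \<open>A\<close> and \<open>B\<close> are products of powers, and \<open>S\<close> and \<open>T\<close> are the factors whose
  exponent is raised. The factorisation of \<open>B\<close> through \<open>T\<close> says that \<open>T\<close> occurs in \<open>B\<close> with a positive exponent;
  it turns smallness of \<open>T f\<close> into smallness of \<open>B f\<close>.
\<close>

lemma opnorm_diff_less_one_step:
  assumes A: "l1_positive_contraction M A" and B: "l1_positive_contraction M B"
    and B': "l1_positive_contraction M B'"
    and S: "l1_positive_contraction M S" and T: "l1_positive_contraction M T"
    and TS: "l1_le M T S" and BA: "l1_le M B A"
    and AS_comm: "l1_op_eq M (A \<circ> S) (S \<circ> A)" and BT_comm: "l1_op_eq M (B \<circ> T) (T \<circ> B)"
    and factor: "l1_op_eq M B (B' \<circ> T)"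
    and less: "l1_opnorm M (l1_diff A B) < 1"
  shows "l1_opnorm M (l1_diff (S \<circ> A) (T \<circ> B)) < 1"
proof -
  note lins = A[THEN positive_contraction_linear] B[THEN positive_contraction_linear]
    B'[THEN positive_contraction_linear] S[THEN positive_contraction_linear]
    T[THEN positive_contraction_linear]
  note poss = A[THEN positive_contraction_positive] B[THEN positive_contraction_positive]
    S[THEN positive_contraction_positive] T[THEN positive_contraction_positive]
  have "l1_opnorm M (l1_diff A B) \<noteq> top"
    using less by auto
  then obtain q where q0: "0 \<le> q" and q: "l1_opnorm M (l1_diff A B) = ennreal q"
    by (cases "l1_opnorm M (l1_diff A B)") auto
  from less q q0 have q1: "q < 1"
    by (simp add: ennreal_less_one_iff)
  have diff: "(\<integral>x. A h x \<partial>M) - (\<integral>x. B h x \<partial>M) \<le> q * (\<integral>x. h x \<partial>M)"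
    if h: "integrable M h" "AE x in M. 0 \<le> h x" for h
  proof -
    have Ah: "integrable M (A h)" and Bh: "integrable M (B h)"
      using h lins[THEN l1_linear_integrable] by auto
    have "(\<integral>x. A h x \<partial>M) - (\<integral>x. B h x \<partial>M) = (\<integral>x. A h x - B h x \<partial>M)"
      using Ah Bh by simp
    also have "\<dots> \<le> l1_norm M (l1_diff A B h)"
      unfolding l1_norm_def l1_diff_def using Ah Bh by (intro integral_mono) auto
    also have "\<dots> \<le> q * l1_norm M h"
      using q q0 lins h by (intro l1_norm_le_opnorm l1_linear_diff) auto
    also have "l1_norm M h = (\<integral>x. h x \<partial>M)"
      using h by (rule l1_norm_nonneg_fun)
    finally show ?thesis .
  qed
  \<comment> \<open>solving \<open>1 - q \<le> d + d / (1 - q)\<close> for the defect \<open>d\<close> bounds \<open>1 - d\<close> by this value\<close>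
  define r where "r = 1 - (1 - q)\<^sup>2 / (2 - q)"
  have r0: "0 \<le> r"
  proof -
    have "(1 - q)\<^sup>2 \<le> 1 * (2 - q)"
      unfolding power2_eq_square using q0 q1 by (intro mult_mono) auto
    then show ?thesis
      using q1 by (simp add: r_def)
  qed
  have r1: "r < 1"
    using q1 by (simp add: r_def)
  have cone: "(\<integral>x. l1_diff (S \<circ> A) (T \<circ> B) f x \<partial>M) \<le> r * (\<integral>x. f x \<partial>M)"
    if f: "integrable M f" "AE x in M. 0 \<le> f x" for f
  proof -
    have ints: "integrable M (S f)" "integrable M (T f)" "integrable M (A f)" "integrable M (B f)"
      "integrable M (S (A f))" "integrable M (T (B f))" "integrable M (A (S f))"
      "integrable M (B (T f))" "integrable M (B' (T f))"
      using f lins[THEN l1_linear_integrable] by auto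
    have nonneg: "AE x in M. 0 \<le> S f x" "AE x in M. 0 \<le> T f x" "AE x in M. 0 \<le> A f x"
      using f poss[THEN l1_positiveD] by auto
    define u where "u = (\<integral>x. f x \<partial>M)"
    define t where "t = (\<integral>x. T f x \<partial>M)"
    define d where "d = u - ((\<integral>x. S (A f) x \<partial>M) - (\<integral>x. T (B f) x \<partial>M))"
    have ASf: "(\<integral>x. A (S f) x \<partial>M) = (\<integral>x. S (A f) x \<partial>M)"
      using ints l1_op_eqD[OF AS_comm f(1)] by (intro integral_cong_AE) auto
    have BTf: "(\<integral>x. B (T f) x \<partial>M) = (\<integral>x. T (B f) x \<partial>M)"
      using ints l1_op_eqD[OF BT_comm f(1)] by (intro integral_cong_AE) auto
    have "AE x in M. 0 \<le> B f x"
      using f by (intro l1_positiveD[OF poss(2)])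
    then have TBf: "0 \<le> (\<integral>x. T (B f) x \<partial>M)"
      using ints by (intro integral_nonneg_AE l1_positiveD[OF poss(4)])
    \<comment> \<open>\<open>A\<close> loses no more mass of \<open>T f\<close> than of \<open>S f\<close>, and \<open>A - B\<close> contracts \<open>T f\<close> by \<open>q\<close>\<close>
    have "t - (\<integral>x. A (T f) x \<partial>M) \<le> (\<integral>x. S f x \<partial>M) - (\<integral>x. A (S f) x \<partial>M)"
      unfolding t_def using A ints(2,1) l1_leD[OF TS f]
      by (rule positive_contraction_loss_mono)
    moreover have "(\<integral>x. S f x \<partial>M) \<le> u"
      unfolding u_def using S f by (rule positive_contraction_integral_le)
    moreover have "(\<integral>x. A (T f) x \<partial>M) - (\<integral>x. B (T f) x \<partial>M) \<le> q * t"
      unfolding t_def using ints(2) nonneg(2) by (rule diff)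
    ultimately have t_small: "(1 - q) * t \<le> d"
      unfolding d_def ASf BTf by (simp add: algebra_simps)
    have "(\<integral>x. B f x \<partial>M) = (\<integral>x. B' (T f) x \<partial>M)"
      using ints l1_op_eqD[OF factor f(1)] by (intro integral_cong_AE) auto
    also have "\<dots> \<le> t"
      unfolding t_def using B' ints(2) nonneg(2) by (rule positive_contraction_integral_le)
    finally have Bf: "(\<integral>x. B f x \<partial>M) \<le> t" .
    have "(\<integral>x. S (A f) x \<partial>M) \<le> (\<integral>x. A f x \<partial>M)"
      using S ints(3) nonneg(3) by (rule positive_contraction_integral_le)
    then have "u - d \<le> q * u + t"
      using diff[OF f] Bf TBf unfolding d_def u_def by simp
    then have "(1 - q) * ((1 - q) * u) \<le> (1 - q) * (d + t)"
      using q1 by (intro mult_left_mono) (auto simp: algebra_simps)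
    then have "(1 - q)\<^sup>2 * u \<le> (2 - q) * d"
      using t_small by (simp add: algebra_simps power2_eq_square)
    then have "(1 - q)\<^sup>2 / (2 - q) * u \<le> d"
      using q1 by (simp add: field_simps)
    then have "u - d \<le> r * u"
      by (simp add: r_def algebra_simps)
    then show ?thesis
      using ints unfolding l1_diff_def d_def u_def by simp
  qed
  have "l1_le M (T \<circ> B) (S \<circ> A)"
    using T S B A TS BA by (rule l1_le_comp_contractions)
  then have "l1_opnorm M (l1_diff (S \<circ> A) (T \<circ> B)) \<le> ennreal r"
    using lins r0 cone
    by (intro l1_opnorm_le_of_cone l1_linear_diff l1_linear_comp) (auto simp: l1_le_def)
  also have "\<dots> < 1"
    using r0 r1 by (simp add: ennreal_less_one_iff)
  finally show ?thesis .
qed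

section \<open>Products of powers of commuting operators\<close>

text \<open>
  The factors are indexed by an arbitrary list, which makes products accessible to induction.
\<close>

definition monomial :: "(nat \<Rightarrow> 'b \<Rightarrow> 'b) \<Rightarrow> (nat \<Rightarrow> nat) \<Rightarrow> nat list \<Rightarrow> 'b \<Rightarrow> 'b" where
  "monomial T n xs = foldr (\<lambda>i P. (T i ^^ n i) \<circ> P) xs id"

lemma monomial_simps [simp]:
  "monomial T n [] = id"
  "monomial T n (x # xs) = (T x ^^ n x) \<circ> monomial T n xs"
  by (simp_all add: monomial_def)

lemma monomial_cong: "(\<And>i. i \<in> set xs \<Longrightarrow> n i = m i) \<Longrightarrow> monomial T n xs = monomial T m xs"
  by (induction xs) auto

lemma positive_contraction_monomial:
  "(\<And>i. i \<in> set xs \<Longrightarrow> l1_positive_contraction M (T i))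
    \<Longrightarrow> l1_positive_contraction M (monomial T n xs)"
  by (induction xs)
    (auto simp: positive_contraction_id intro: positive_contraction_comp positive_contraction_funpow)

lemma l1_le_monomial:
  assumes "\<And>i. i \<in> set xs \<Longrightarrow> l1_positive_contraction M (T i)"
    and "\<And>i. i \<in> set xs \<Longrightarrow> l1_positive_contraction M (S i)"
    and "\<And>i. i \<in> set xs \<Longrightarrow> l1_le M (T i) (S i)"
  shows "l1_le M (monomial T n xs) (monomial S n xs)"
  using assms
  by (induction xs)
    (auto simp: l1_le_refl
       intro!: l1_le_comp_contractions positive_contraction_funpow positive_contraction_monomial
         l1_le_funpow)

lemma l1_linear_monomial:
  "(\<And>i. i \<in> set xs \<Longrightarrow> l1_linear M (T i)) \<Longrightarrow> l1_linear M (monomial T n xs)"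
  by (induction xs) (auto simp: l1_linear_id intro: l1_linear_comp l1_linear_funpow)

lemma l1_op_eq_commute_comp:
  assumes lin: "l1_linear M R" "l1_linear M P" "l1_linear M Q"
    and P: "l1_op_eq M (P \<circ> R) (R \<circ> P)" and Q: "l1_op_eq M (Q \<circ> R) (R \<circ> Q)"
  shows "l1_op_eq M ((P \<circ> Q) \<circ> R) (R \<circ> (P \<circ> Q))"
proof -
  have "l1_op_eq M (P \<circ> (Q \<circ> R)) (P \<circ> (R \<circ> Q))"
    using lin by (intro l1_op_eq_comp_left[OF Q] l1_linear_comp)
  also have "l1_op_eq M ((P \<circ> R) \<circ> Q) ((R \<circ> P) \<circ> Q)"
    using lin by (intro l1_op_eq_comp_right[OF P])
  then have "l1_op_eq M (P \<circ> (R \<circ> Q)) (R \<circ> (P \<circ> Q))"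
    by (simp add: comp_assoc)
  finally show ?thesis
    by (simp add: comp_assoc)
qed

lemma l1_op_eq_commute_funpow:
  assumes "l1_linear M R" "l1_linear M P" "l1_op_eq M (P \<circ> R) (R \<circ> P)"
  shows "l1_op_eq M ((P ^^ n) \<circ> R) (R \<circ> (P ^^ n))"
proof (induction n)
  case 0
  show ?case by (simp add: l1_op_eq_refl)
next
  case (Suc n)
  then show ?case
    using assms by (simp del: o_apply) (intro l1_op_eq_commute_comp l1_linear_funpow)
qed

lemma l1_op_eq_commute_monomial:
  assumes "\<And>j. j \<in> set xs \<Longrightarrow> l1_linear M (T j)" "l1_linear M R"
    and "\<And>j. j \<in> set xs \<Longrightarrow> l1_op_eq M (T j \<circ> R) (R \<circ> T j)"
  shows "l1_op_eq M (monomial T n xs \<circ> R) (R \<circ> monomial T n xs)"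
  using assms
proof (induction xs)
  case Nil
  show ?case by (simp add: l1_op_eq_refl)
next
  case (Cons x xs)
  note x = list.set_intros(1)[of x xs] and xs = list.set_intros(2)[of _ xs x]
  show ?case
    unfolding monomial_simps
    by (intro l1_op_eq_commute_comp l1_op_eq_commute_funpow l1_linear_funpow l1_linear_monomial
          Cons.IH Cons.prems x xs)
qed

lemma monomial_raise_exponent:
  assumes "\<And>j. j \<in> set xs \<Longrightarrow> l1_linear M (T j)"
    and "\<And>j. j \<in> set xs \<Longrightarrow> l1_op_eq M (T j \<circ> T i) (T i \<circ> T j)"
    and "i \<in> set xs" "distinct xs"
  shows "l1_op_eq M (monomial T (n(i := Suc (n i))) xs) (T i \<circ> monomial T n xs)"
  using assms
proof (induction xs)
  case Nil
  then show ?case by simp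
next
  case (Cons x xs)
  let ?n' = "n(i := Suc (n i))"
  have i: "l1_linear M (T i)" and x: "l1_linear M (T x)"
    and xs: "\<And>m. l1_linear M (monomial T m xs)"
    using Cons.prems by (auto intro: l1_linear_monomial)
  show ?case
  proof (cases "x = i")
    case True
    then have "monomial T ?n' xs = monomial T n xs"
      using Cons.prems by (intro monomial_cong) auto
    with True show ?thesis
      by (simp only: monomial_simps fun_upd_same funpow.simps comp_assoc l1_op_eq_refl)
  next
    case False
    then have "l1_op_eq M (monomial T ?n' xs) (T i \<circ> monomial T n xs)"
      using Cons.prems by (intro Cons.IH) auto
    then have "l1_op_eq M ((T x ^^ n x) \<circ> monomial T ?n' xs)
        ((T x ^^ n x) \<circ> (T i \<circ> monomial T n xs))"
      using i x xs by (intro l1_op_eq_comp_left l1_linear_funpow l1_linear_comp)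
    also have "l1_op_eq M (((T x ^^ n x) \<circ> T i) \<circ> monomial T n xs)
        ((T i \<circ> (T x ^^ n x)) \<circ> monomial T n xs)"
      using i x xs
      by (intro l1_op_eq_comp_right l1_op_eq_commute_funpow Cons.prems(2) list.set_intros(1))
    then have "l1_op_eq M ((T x ^^ n x) \<circ> (T i \<circ> monomial T n xs))
        (T i \<circ> ((T x ^^ n x) \<circ> monomial T n xs))"
      by (simp add: comp_assoc)
    finally show ?thesis
      by (simp only: monomial_simps fun_upd_other[OF False])
  qed
qed

text \<open>
  The positive exponent in the second product is what lets one copy of the raised factor be split
  off from it on the right.
\<close>

lemma opnorm_monomial_diff_raise_exponent:
  assumes T: "\<And>j. j \<in> set xs \<Longrightarrow> l1_positive_contraction M (T j)"
    and S: "\<And>j. j \<in> set xs \<Longrightarrow> l1_positive_contraction M (S j)"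
    and TS: "\<And>j. j \<in> set xs \<Longrightarrow> l1_le M (T j) (S j)"
    and Tcomm: "\<And>j. j \<in> set xs \<Longrightarrow> l1_op_eq M (T j \<circ> T i) (T i \<circ> T j)"
    and Scomm: "\<And>j. j \<in> set xs \<Longrightarrow> l1_op_eq M (S j \<circ> S i) (S i \<circ> S j)"
    and i: "i \<in> set xs" and xs: "distinct xs" and pos: "1 \<le> n i"
    and less: "l1_opnorm M (l1_diff (monomial S n xs) (monomial T n xs)) < 1"
  shows "l1_opnorm M (l1_diff (monomial S (n(i := Suc (n i))) xs)
           (monomial T (n(i := Suc (n i))) xs)) < 1"
proof -
  have Tlin: "\<And>j. j \<in> set xs \<Longrightarrow> l1_linear M (T j)"
    and Slin: "\<And>j. j \<in> set xs \<Longrightarrow> l1_linear M (S j)"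
    using T S by (auto intro: positive_contraction_linear)
  let ?B = "monomial T n xs" and ?n' = "n(i := n i - 1)"
  let ?B' = "monomial T ?n' xs"
  have "l1_op_eq M (monomial T (?n'(i := Suc (?n' i))) xs) (T i \<circ> ?B')"
    using Tlin Tcomm i xs by (rule monomial_raise_exponent)
  moreover have "?n'(i := Suc (?n' i)) = n"
    using pos by auto
  ultimately have "l1_op_eq M ?B (T i \<circ> ?B')"
    by metis
  also have "l1_op_eq M (T i \<circ> ?B') (?B' \<circ> T i)"
    using Tlin Tcomm i by (intro l1_op_eq_sym[OF l1_op_eq_commute_monomial])
  finally have factor: "l1_op_eq M ?B (?B' \<circ> T i)" .
  have "l1_opnorm M (l1_diff (S i \<circ> monomial S n xs) (T i \<circ> ?B)) < 1"
  proof (rule opnorm_diff_less_one_step[OF _ _ _ _ _ _ _ _ _ factor less])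
    show "l1_op_eq M (monomial S n xs \<circ> S i) (S i \<circ> monomial S n xs)"
      using Slin Scomm i by (intro l1_op_eq_commute_monomial)
    show "l1_op_eq M (?B \<circ> T i) (T i \<circ> ?B)"
      using Tlin Tcomm i by (intro l1_op_eq_commute_monomial)
  qed (use T S TS i in \<open>auto intro: positive_contraction_monomial l1_le_monomial\<close>)
  moreover have "l1_opnorm M (l1_diff (monomial S (n(i := Suc (n i))) xs)
        (monomial T (n(i := Suc (n i))) xs))
      = l1_opnorm M (l1_diff (S i \<circ> monomial S n xs) (T i \<circ> ?B))"
    using Tlin Slin Tcomm Scomm i xs
    by (intro l1_opnorm_diff_cong monomial_raise_exponent l1_linear_comp l1_linear_monomial)
  ultimately show ?thesis
    by simp
qed

theorem theorem2p3:
  fixes M :: "'a measure"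
    and N :: nat
    and T S :: "nat \<Rightarrow> ('a \<Rightarrow> real) \<Rightarrow> ('a \<Rightarrow> real)"
    and n0 :: "nat \<Rightarrow> nat"
  assumes "N \<ge> 1"
    and "\<And>i. i \<in> {1..N} \<Longrightarrow> l1_positive_contraction M (T i)"
    and "\<And>i. i \<in> {1..N} \<Longrightarrow> l1_positive_contraction M (S i)"
    and "\<And>i. i \<in> {1..N} \<Longrightarrow> l1_le M (T i) (S i)"
    and "\<And>i j. i \<in> {1..N} \<Longrightarrow> j \<in> {1..N} \<Longrightarrow> l1_op_eq M (T i \<circ> T j) (T j \<circ> T i)"
    and "\<And>i j. i \<in> {1..N} \<Longrightarrow> j \<in> {1..N} \<Longrightarrow> l1_op_eq M (S i \<circ> S j) (S j \<circ> S i)"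
    and "\<And>i. i \<in> {1..N} \<Longrightarrow> n0 i \<ge> 1"
    and "l1_opnorm M (l1_diff (prod_powers N S n0) (prod_powers N T n0)) < 1"
  shows "\<forall>m :: nat \<Rightarrow> nat. (\<forall>i\<in>{1..N}. m i \<ge> n0 i) \<longrightarrow>
           l1_opnorm M (l1_diff (prod_powers N S m) (prod_powers N T m)) < 1"
proof (intro allI impI)
  let ?xs = "[1..<Suc N]"
  have set_xs: "set ?xs = {1..N}"
    by auto
  have prod: "prod_powers N R n = monomial R n ?xs"
    for R :: "nat \<Rightarrow> ('a \<Rightarrow> real) \<Rightarrow> ('a \<Rightarrow> real)" and n
    by (simp only: prod_powers_def monomial_def)
  fix m :: "nat \<Rightarrow> nat"
  assume "\<forall>i\<in>{1..N}. n0 i \<le> m i"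
  then show "l1_opnorm M (l1_diff (prod_powers N S m) (prod_powers N T m)) < 1"
  proof (induction "sum m {1..N}" arbitrary: m rule: less_induct)
    case less
    show ?case
    proof (cases "\<forall>i\<in>{1..N}. m i = n0 i")
      case True
      then have "monomial R m ?xs = monomial R n0 ?xs"
        for R :: "nat \<Rightarrow> ('a \<Rightarrow> real) \<Rightarrow> ('a \<Rightarrow> real)"
        by (intro monomial_cong) (simp only: set_xs)
      with assms(8) show ?thesis
        by (simp only: prod)
    next
      case False
      with less.prems obtain i where i: "i \<in> {1..N}" and "n0 i < m i"
        by (metis le_neq_implies_less)
      define n where "n = m(i := m i - 1)"
      have n_ge: "\<forall>j\<in>{1..N}. n0 j \<le> n j"
        using less.prems \<open>n0 i < m i\<close> by (auto simp: n_def)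
      have m_eq: "m = n(i := Suc (n i))"
        using \<open>n0 i < m i\<close> by (auto simp: n_def)
      have "sum n {1..N} < sum m {1..N}"
        using i \<open>n0 i < m i\<close> by (intro sum_strict_mono_ex1) (auto simp: n_def)
      then have "l1_opnorm M (l1_diff (monomial S n ?xs) (monomial T n ?xs)) < 1"
        using less.hyps n_ge by (simp only: prod)
      moreover have "1 \<le> n i"
        using n_ge assms(7) i by (meson le_trans)
      ultimately show ?thesis
        unfolding prod m_eq using assms(2-6) i
        by (intro opnorm_monomial_diff_raise_exponent) (simp_all only: set_xs distinct_upt)
    qed
  qed
qed

end
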